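(* Let $0<p<1$. Consider a row of $n\ge1$ seats with a single entrance at one end, filled by $p$-courteous theatregoers who choose seats uniformly at random among the accessible empty seats (model described in the context). The expected number $E_n$ of occupied seats when the process ends is $$E_n=\sum_{k=1}^n \frac{1-p^k}{k(1-p)}.$$ In particular, for fixed $p$, $E_n=\frac{H_n+\ln(1-p)}{1-p}+o(1)$ as $n\to\infty$, where $H_n=\sum_{k=1}^n\frac1k$.
   Context: Row model: a row consists of $n$ seats numbered $1,\dots,n$ from left to right, with a single entrance at the left end. Theatregoers arrive one at a time. Each theatregoer is, independently of all others, courteous with probability $p$ and selfish with probability $1-p$ ("$p$-courteous"), and this status never changes. A seated selfish theatregoer never gets up, so no later theatregoer can walk past her seat; a seated courteous theatregoer always gets up to let others pass and so never blocks. An empty seat is accessible if it can be reached from the entrance without passing a seat occupied by a selfish theatregoer. Each arriving theatregoer sits in an accessible empty seat chosen uniformly at random among all accessible empty seats; the process ends when no accessible empty seat remains. *)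

theory Defs
  imports "HOL-Probability.Probability" "HOL-Library.Landau_Symbols"
begin

datatype status = Courteous | Selfish

text \<open>Seat \<open>i\<close> is empty iff \<open>r i = None\<close>; otherwise \<open>r i\<close> gives the status of its occupant.
  The entrance is to the left of seat \<open>1\<close>.\<close>

type_synonym row = "nat \<rightharpoonup> status"

definition accessible :: "nat \<Rightarrow> row \<Rightarrow> nat set" where
  "accessible n r = {i \<in> {1..n}. r i = None \<and> (\<forall>j \<in> {1..<i}. r j \<noteq> Some Selfish)}"

definition status_pmf :: "real \<Rightarrow> status pmf" where
  "status_pmf p = map_pmf (\<lambda>b. if b then Courteous else Selfish) (bernoulli_pmf p)"

text \<open>One arrival; only meaningful if some empty seat is accessible.\<close>

definition arrival :: "real \<Rightarrow> nat \<Rightarrow> row \<Rightarrow> row pmf" where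
  "arrival p n r =
     do {
       c \<leftarrow> status_pmf p;
       i \<leftarrow> pmf_of_set (accessible n r);
       return_pmf (r(i \<mapsto> c))
     }"

lemma finite_accessible [simp]: "finite (accessible n r)"
  by (simp add: accessible_def)

lemma accessible_arrival_less:
  assumes "accessible n r \<noteq> {}" "r' \<in> set_pmf (arrival p n r)"
  shows "card (accessible n r') < card (accessible n r)"
proof -
  obtain c i where i: "i \<in> accessible n r" and r': "r' = r(i \<mapsto> c)"
    using assms by (auto simp: arrival_def)
  have "accessible n r' \<subseteq> accessible n r - {i}"
    using i unfolding r' by (auto simp: accessible_def split: if_splits)
  then have "accessible n r' \<subset> accessible n r"
    using i by blast
  then show ?thesis
    by (simp add: psubset_card_mono)
qed

text \<open>Distribution of the row when the process, started in row \<open>r\<close>, ends.\<close>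

context
  notes bind_pmf_cong [fundef_cong]
begin

function final_row :: "real \<Rightarrow> nat \<Rightarrow> row \<Rightarrow> row pmf" where
  "final_row p n r =
     (if accessible n r = {} then return_pmf r
      else bind_pmf (arrival p n r) (\<lambda>r'. final_row p n r'))"
  by pat_completeness auto
termination
  by (relation "Wellfounded.measure (\<lambda>(p, n, r). card (accessible n r))")
    (auto simp: accessible_arrival_less)

end

declare final_row.simps [simp del]

definition expected_occupied :: "real \<Rightarrow> nat \<Rightarrow> real" where
  "expected_occupied p n =
     measure_pmf.expectation (final_row p n Map.empty) (\<lambda>r. real (card (dom r)))"

end

theory Submission
  imports Defs
begin

text \<open>
  The number of seats still to be filled depends on the current row only through the number
  \<open>m\<close> of accessible empty seats. A courteous arrival leaves \<open>m - 1\<close> of them accessible, a selfish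
  one leaves a uniformly distributed number \<open>j \<in> {0..<m}\<close>. Hence the expected number \<open>F m\<close> of further
  arrivals satisfies \<open>F m = 1 + p F (m - 1) + (1 - p) / m (\<Sum>j<m. F j)\<close>. Subtracting consecutive
  instances shows that \<open>d m = F m - F (m - 1)\<close> satisfies \<open>(m + 1) d (m + 1) = 1 + p m d m\<close>, whence
  \<open>m d m = 1 + p + \<dots> + p ^ (m - 1)\<close>. The asymptotics is the power series of \<open>ln (1 - p)\<close>.
\<close>

text \<open>The closed form serves as the definition; \<open>expectation_final_row\<close>
  identifies it with the expected number of further arrivals.\<close>

definition expected_further :: "real \<Rightarrow> nat \<Rightarrow> real" where
  "expected_further p m = (\<Sum>k=1..m. (1 - p ^ k) / (real k * (1 - p)))"

lemma expected_further_Suc: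
  "expected_further p (Suc m) =
     expected_further p m + (1 - p ^ Suc m) / (real (Suc m) * (1 - p))"
  by (simp add: expected_further_def)

lemma expected_further_recurrence:
  assumes "p \<noteq> 1"
  shows "real (Suc m) * expected_further p (Suc m) =
    real (Suc m) + p * real (Suc m) * expected_further p m
      + (1 - p) * (\<Sum>j<Suc m. expected_further p j)"
proof (induction m)
  case 0
  then show ?case
    using assms by (simp add: expected_further_def)
next
  case (Suc m)
  have mult_increment: "real (Suc k) * expected_further p (Suc k) =
      real (Suc k) * expected_further p k + (1 - p ^ Suc k) / (1 - p)" for k
    unfolding expected_further_Suc by (simp add: distrib_left del: of_nat_Suc)
  have geometric: "(1 - p ^ Suc (Suc m)) / (1 - p) = 1 + p * ((1 - p ^ Suc m) / (1 - p))"
    using assms by (simp add: field_simps)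
  define F0 F1 F2 where "F0 = expected_further p m" and "F1 = expected_further p (Suc m)"
    and "F2 = expected_further p (Suc (Suc m))"
  define S where "S = (\<Sum>j<Suc m. expected_further p j)"
  define q where "q = (1 - p ^ Suc m) / (1 - p)"
  have "real (Suc m) * F1 = real (Suc m) * F0 + q"
    and "real (Suc (Suc m)) * F2 = real (Suc (Suc m)) * F1 + (1 + p * q)"
    and "real (Suc m) * F1 = real (Suc m) + p * real (Suc m) * F0 + (1 - p) * S"
    using mult_increment[of m] mult_increment[of "Suc m"] Suc.IH
    unfolding geometric F0_def F1_def F2_def S_def q_def by blast+
  \<comment> \<open>Eliminating \<open>S\<close> by the induction hypothesis and \<open>q\<close> by
    the increment equation for \<open>F1\<close> leaves a polynomial identity.\<close>
  then have "real (Suc (Suc m)) * F2 =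
      real (Suc (Suc m)) + p * real (Suc (Suc m)) * F1 + (1 - p) * (S + F1)"
    unfolding of_nat_Suc by algebra
  then show ?case
    unfolding F1_def F2_def S_def by (simp only: sum.lessThan_Suc)
qed

text \<open>Ranking maps \<open>A\<close> bijectively onto the numbers below \<open>card A\<close>:
  a new maximum gets rank \<open>card A\<close> and leaves the other ranks unchanged. Hence a
  selfish arrival leaves a uniformly distributed number of accessible seats.\<close>

lemma sum_card_less_eq_sum_lessThan:
  fixes A :: "'a::linorder set"
  assumes "finite A"
  shows "(\<Sum>i\<in>A. f (card {j \<in> A. j < i})) = (\<Sum>k<card A. f k)"
  using assms
proof (induction A rule: finite_linorder_max_induct)
  case empty
  then show ?case by simp
next
  case (insert b A)
  have "{j \<in> insert b A. j < b} = A"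
    using insert by auto
  moreover have "{j \<in> insert b A. j < i} = {j \<in> A. j < i}" if "i \<in> A" for i
    using insert that by auto
  moreover have "b \<notin> A"
    using insert by auto
  ultimately show ?case
    using insert by (simp add: add.commute)
qed

lemma accessible_upd_Courteous:
  assumes "i \<in> accessible n r"
  shows "accessible n (r(i \<mapsto> Courteous)) = accessible n r - {i}"
  using assms by (auto simp: accessible_def split: if_splits)

lemma accessible_upd_Selfish:
  assumes "i \<in> accessible n r"
  shows "accessible n (r(i \<mapsto> Selfish)) = {j \<in> accessible n r. j < i}"
  using assms by (auto simp: accessible_def split: if_splits)

lemma set_pmf_status_pmf:
  assumes "0 < p" "p < 1"
  shows "set_pmf (status_pmf p) = UNIV"
  using assms status.exhaust by (auto simp: status_pmf_def UNIV_bool)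

lemma finite_set_pmf_arrival:
  assumes "accessible n r \<noteq> {}"
  shows "finite (set_pmf (arrival p n r))"
  using assms by (simp add: arrival_def status_pmf_def)

text \<open>Finite support turns expectations into finite sums, so no integrability questions
  arise.\<close>

lemma finite_set_pmf_final_row: "finite (set_pmf (final_row p n r))"
proof (induction p n r rule: final_row.induct)
  case (1 p n r)
  then show ?case
    by (subst final_row.simps) (auto simp: finite_set_pmf_arrival)
qed

lemma expectation_arrival:
  fixes h :: "row \<Rightarrow> real"
  assumes "0 \<le> p" "p \<le> 1" "accessible n r \<noteq> {}"
  shows "measure_pmf.expectation (arrival p n r) h =
    (p * (\<Sum>i\<in>accessible n r. h (r(i \<mapsto> Courteous)))
      + (1 - p) * (\<Sum>i\<in>accessible n r. h (r(i \<mapsto> Selfish)))) / card (accessible n r)"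
proof -
  have seat: "measure_pmf.expectation
        (pmf_of_set (accessible n r) \<bind> (\<lambda>i. return_pmf (r(i \<mapsto> c)))) h =
      (\<Sum>i\<in>accessible n r. h (r(i \<mapsto> c))) / card (accessible n r)" for c
    using assms(3) by (simp add: map_pmf_def[symmetric] integral_pmf_of_set)
  have "measure_pmf.expectation (arrival p n r) h =
      (\<Sum>b\<in>UNIV. pmf (bernoulli_pmf p) b * measure_pmf.expectation
        (pmf_of_set (accessible n r) \<bind>
          (\<lambda>i. return_pmf (r(i \<mapsto> (if b then Courteous else Selfish))))) h)"
    unfolding arrival_def status_pmf_def bind_map_pmf
    using assms(3) by (subst pmf_expectation_bind[where A = UNIV]) simp_all
  then show ?thesis
    using assms(1,2) by (simp add: seat UNIV_bool add_divide_distrib add.commute)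
qed

text \<open>Starting from an arbitrary row makes the induction along the process possible.
  Finiteness of \<open>dom r\<close> ensures that \<open>card\<close> grows by one with each
  arrival.\<close>

lemma expectation_final_row:
  assumes "0 < p" "p < 1" "finite (dom r)"
  shows "measure_pmf.expectation (final_row p n r) (\<lambda>r. real (card (dom r))) =
    real (card (dom r)) + expected_further p (card (accessible n r))"
  using assms
proof (induction p n r rule: final_row.induct)
  case (1 p n r)
  show ?case
  proof (cases "accessible n r = {}")
    case True
    then show ?thesis
      by (simp add: final_row.simps expected_further_def)
  next
    case False
    let ?A = "accessible n r"
    define h where
      "h r' = measure_pmf.expectation (final_row p n r') (\<lambda>r. real (card (dom r)))" for r'
    obtain m where m: "card ?A = Suc m"
      using False by (metis card_eq_0_iff finite_accessible not0_implies_Suc)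
    have h: "h (r(i \<mapsto> c)) =
        real (card (dom r)) + 1 + expected_further p (card (accessible n (r(i \<mapsto> c))))"
      if i: "i \<in> ?A" for i c
    proof -
      \<comment> \<open>The induction hypothesis covers only rows in the support of
        \<open>arrival\<close>; as 0 < p < 1, both statuses occur there.\<close>
      have "r(i \<mapsto> c) \<in> set_pmf (arrival p n r)"
        using i False "1.prems" by (auto simp: arrival_def set_pmf_status_pmf)
      moreover have "i \<notin> dom r"
        using i by (auto simp: accessible_def)
      ultimately show ?thesis
        using "1.IH"[OF False] "1.prems" by (simp add: h_def)
    qed
    have courteous: "(\<Sum>i\<in>?A. h (r(i \<mapsto> Courteous))) =
        real (Suc m) * (real (card (dom r)) + 1 + expected_further p m)"
      by (simp add: h accessible_upd_Courteous m)
    have selfish: "(\<Sum>i\<in>?A. h (r(i \<mapsto> Selfish))) =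
        real (Suc m) * (real (card (dom r)) + 1) + (\<Sum>j<Suc m. expected_further p j)"
      using sum_card_less_eq_sum_lessThan[of ?A "expected_further p"]
      by (simp add: h accessible_upd_Selfish sum.distrib m)
    have "measure_pmf.expectation (final_row p n r) (\<lambda>r. real (card (dom r))) =
        measure_pmf.expectation (arrival p n r) h"
    proof -
      have finite_arrival: "finite (set_pmf (arrival p n r))"
        by (rule finite_set_pmf_arrival[OF False])
      have "measure_pmf.expectation (arrival p n r) h =
          (\<Sum>r'\<in>set_pmf (arrival p n r). pmf (arrival p n r) r' *\<^sub>R h r')"
        by (rule integral_measure_pmf[OF finite_arrival])
      then show ?thesis
        using False finite_arrival finite_set_pmf_final_row
        by (subst final_row.simps)
          (simp add: h_def pmf_expectation_bind[OF _ _ order_refl])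
    qed
    also have "\<dots> = (p * (real (Suc m) * (real (card (dom r)) + 1 + expected_further p m))
        + (1 - p) * (real (Suc m) * (real (card (dom r)) + 1)
          + (\<Sum>j<Suc m. expected_further p j))) / real (Suc m)"
      using expectation_arrival[OF _ _ False, of p h] "1.prems"
      unfolding courteous selfish m by auto
    \<comment> \<open>The recurrence absorbs the newly seated person, the summand 1, into
      \<open>expected_further p (Suc m)\<close>.\<close>
    also have "\<dots> = (real (Suc m) * real (card (dom r))
        + real (Suc m) * expected_further p (Suc m)) / real (Suc m)"
      using "1.prems" by (subst expected_further_recurrence) (simp_all add: algebra_simps del: of_nat_Suc sum.lessThan_Suc)
    also have "\<dots> = real (card (dom r)) + expected_further p (card ?A)"
      by (simp add: m add_divide_distrib del: of_nat_Suc)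
    finally show ?thesis .
  qed
qed

lemma expected_occupied_eq:
  assumes "0 < p" "p < 1"
  shows "expected_occupied p n = (\<Sum>k=1..n. (1 - p ^ k) / (real k * (1 - p)))"
proof -
  have "accessible n Map.empty = {1..n}"
    by (auto simp: accessible_def)
  then show ?thesis
    using expectation_final_row[OF assms, of Map.empty n]
    by (simp add: expected_occupied_def expected_further_def)
qed

lemma expected_occupied_minus_harm:
  assumes "0 < p" "p < 1"
  shows "expected_occupied p n - (harm n + ln (1 - p)) / (1 - p) =
    ((\<Sum>k\<le>n. - (p ^ k) / real k) - ln (1 - p)) / (1 - p)"
proof -
  \<comment> \<open>The extra term at k = 0 vanishes because division by zero yields 0.\<close>
  have "(\<Sum>k\<le>n. - (p ^ k) / real k) = (\<Sum>k=1..n. - (p ^ k) / real k)"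
    by (rule sum.mono_neutral_right) (auto simp: not_le)
  moreover have "expected_occupied p n =
      (harm n + (\<Sum>k=1..n. - (p ^ k) / real k)) / (1 - p)"
    unfolding expected_occupied_eq[OF assms] harm_def sum.distrib[symmetric] sum_divide_distrib
    by (intro sum.cong) (auto simp: field_simps)
  ultimately show ?thesis
    by (simp add: diff_divide_distrib add_divide_distrib)
qed

theorem theorem3:
  fixes p :: real
  assumes "0 < p" and "p < 1"
  shows "(\<forall>n\<ge>1. expected_occupied p n = (\<Sum>k=1..n. (1 - p ^ k) / (real k * (1 - p)))) \<and>
         (\<lambda>n. expected_occupied p n - (harm n + ln (1 - p)) / (1 - p)) \<in> o(\<lambda>n. 1)"
proof
  show "\<forall>n\<ge>1. expected_occupied p n = (\<Sum>k=1..n. (1 - p ^ k) / (real k * (1 - p)))"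
    using assms by (simp add: expected_occupied_eq)
next
  \<comment> \<open>The error term is the remainder of this logarithm series, divided by the
    constant 1 - p, so it tends to 0.\<close>
  have "(\<lambda>k. - (p ^ k) / real k) sums ln (1 - p)"
    using ln_series'[of "- p"] assms by simp
  then have "(\<lambda>n. ((\<Sum>k\<le>n. - (p ^ k) / real k) - ln (1 - p)) / (1 - p))
      \<longlonglongrightarrow> (ln (1 - p) - ln (1 - p)) / (1 - p)"
    unfolding sums_def_le using assms by (intro tendsto_intros) auto
  then show "(\<lambda>n. expected_occupied p n - (harm n + ln (1 - p)) / (1 - p)) \<in> o(\<lambda>n. 1)"
    using assms by (intro smalloI_tendsto) (simp_all add: expected_occupied_minus_harm)
qed

end
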